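(* Let $N\ge 2$ and $m\ge 1$ be integers and let $x^{(r,s)}_k$ ($1\le r,s\le N$, $1\le k\le m$) be elements of a commutative ring; set $x^{(r,s)}_{m+1}=0$ for all $1\le r,s\le N$. Let $G(N,m)$ be the $Nm\times Nm$ matrix which, as an $N\times N$ block matrix with $m\times m$ blocks, has $(r,s)$ block $$G_{rs}=\begin{cases}B_m(x^{(r,s)}_1,\dots,x^{(r,s)}_m), & r,s \text{ odd},\\ C_m(x^{(r,s)}_1,\dots,x^{(r,s)}_m), & r \text{ odd},\ s \text{ even},\\ D_m(x^{(r,s)}_1,\dots,x^{(r,s)}_m), & r \text{ even},\ s \text{ odd},\\ A_m(x^{(r,s)}_1,\dots,x^{(r,s)}_m), & r,s \text{ even}.\end{cases}$$ Then $$\det(G(N,m))=\prod_{i=1}^{m}\det(X_{(i,i+1)}).$$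
   Context: For elements $x_1,\dots,x_m$, the following are $m\times m$ matrices, given by their $(p,q)$ entries: $A_m(x_1,\dots,x_m)$ has entry $x_{m+1-\min(p,q)}$; $B_m(x_1,\dots,x_m)$ has entry $x_{\max(p,q)}$; $C_m(x_1,\dots,x_m)$ has entry $x_{\max(p,\,m+1-q)}$; $D_m(x_1,\dots,x_m)$ has entry $x_{\max(m+1-p,\,q)}$. For $1\le i\le m$, $X_{(i,i+1)}$ is the $N\times N$ matrix whose $(r,s)$ entry is $x^{(r,s)}_i-x^{(r,s)}_{i+1}$. *)

theory Defs
  imports Jordan_Normal_Form.Determinant
begin

text \<open>
  A tuple \<open>x\<^sub>1, \<dots>, x\<^sub>m\<close> is a function on the naturals of which only the values at \<open>1, \<dots>, m\<close> are
  used. Library matrices are indexed from \<open>0\<close>, so the entry written \<open>(p, q)\<close> with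
  \<open>1 \<le> p, q \<le> m\<close> sits at position \<open>(p - 1, q - 1)\<close>.
\<close>

definition mat1 :: "nat \<Rightarrow> (nat \<Rightarrow> nat \<Rightarrow> 'a) \<Rightarrow> 'a mat" where
  "mat1 m f = mat m m (\<lambda>(i, j). f (i + 1) (j + 1))"

definition A_mat :: "nat \<Rightarrow> (nat \<Rightarrow> 'a) \<Rightarrow> 'a mat" where
  "A_mat m x = mat1 m (\<lambda>p q. x (m + 1 - min p q))"

definition B_mat :: "nat \<Rightarrow> (nat \<Rightarrow> 'a) \<Rightarrow> 'a mat" where
  "B_mat m x = mat1 m (\<lambda>p q. x (max p q))"

definition C_mat :: "nat \<Rightarrow> (nat \<Rightarrow> 'a) \<Rightarrow> 'a mat" where
  "C_mat m x = mat1 m (\<lambda>p q. x (max p (m + 1 - q)))"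

definition D_mat :: "nat \<Rightarrow> (nat \<Rightarrow> 'a) \<Rightarrow> 'a mat" where
  "D_mat m x = mat1 m (\<lambda>p q. x (max (m + 1 - p) q))"

text \<open>
  The \<open>N \<times> N\<close> block matrix whose block in block row \<open>r\<close> and block column \<open>s\<close>
  (\<open>1 \<le> r, s \<le> N\<close>) is the \<open>m \<times> m\<close> matrix \<open>M r s\<close>.
\<close>

definition block_mat :: "nat \<Rightarrow> nat \<Rightarrow> (nat \<Rightarrow> nat \<Rightarrow> 'a mat) \<Rightarrow> 'a mat" where
  "block_mat N m M =
     mat (N * m) (N * m) (\<lambda>(i, j). M (i div m + 1) (j div m + 1) $$ (i mod m, j mod m))"

text \<open>In the following, \<open>x r s k\<close> stands for \<open>x\<^sup>(\<^sup>r\<^sup>,\<^sup>s\<^sup>)\<^sub>k\<close>.\<close>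

definition G_block :: "nat \<Rightarrow> (nat \<Rightarrow> nat \<Rightarrow> nat \<Rightarrow> 'a) \<Rightarrow> nat \<Rightarrow> nat \<Rightarrow> 'a mat" where
  "G_block m x r s =
     (if odd r then (if odd s then B_mat m (x r s) else C_mat m (x r s))
      else (if odd s then D_mat m (x r s) else A_mat m (x r s)))"

definition G_mat :: "nat \<Rightarrow> nat \<Rightarrow> (nat \<Rightarrow> nat \<Rightarrow> nat \<Rightarrow> 'a) \<Rightarrow> 'a mat" where
  "G_mat N m x = block_mat N m (G_block m x)"

text \<open>The matrix \<open>X\<close> with index \<open>(i, i + 1)\<close>.\<close>

definition X_mat :: "nat \<Rightarrow> (nat \<Rightarrow> nat \<Rightarrow> nat \<Rightarrow> 'a::comm_ring_1) \<Rightarrow> nat \<Rightarrow> 'a mat" where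
  "X_mat N x i = mat1 N (\<lambda>r s. x r s i - x r s (i + 1))"

end

theory Submission
  imports Defs
begin

text \<open>
  Reversing the rows and columns of \<open>G(N,m)\<close> inside every even block turns each block into a \<open>B\<^sub>m\<close>;
  grouping the indices by their position inside the blocks then gives an \<open>m \<times> m\<close> block matrix with
  \<open>(p, q)\<close> block \<open>Y\<^bsub>max p q\<^esub>\<close>, where \<open>Y\<^sub>k\<close> is the \<open>N \<times> N\<close> matrix with entries
  \<open>x\<^sup>(\<^sup>r\<^sup>,\<^sup>s\<^sup>)\<^sub>k\<close>. Both steps permute rows and columns simultaneously, so the determinant does not
  change. Subtracting the last block column, all of whose blocks are \<open>Y\<^sub>m\<close>, from every other one
  splits off \<open>det Y\<^sub>m\<close> and leaves a matrix of the same shape for \<open>Y\<^sub>k - Y\<^sub>m\<close>, which has the same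
  successive differences.
\<close>

text \<open>The sign of \<open>p\<close> enters once for the rows and once, after transposing, for
  the columns; its square is 1.\<close>

lemma det_permute_rows_cols:
  assumes A: "A \<in> carrier_mat n n" and p: "p permutes {0..<n}"
  shows "det (mat n n (\<lambda>(i, j). A $$ (p i, p j))) = det A"
proof -
  define B where "B = mat n n (\<lambda>(i, j). A $$ (p i, j))"
  have B: "B \<in> carrier_mat n n" by (simp add: B_def)
  have p_less: "p i < n" if "i < n" for i
    using permutes_in_image[OF p, of i] that by simp
  have "mat n n (\<lambda>(i, j). A $$ (p i, p j)) =
      transpose_mat (mat n n (\<lambda>(i, j). transpose_mat B $$ (p i, j)))"
    by (rule eq_matI) (auto simp: B_def p_less)
  then have "det (mat n n (\<lambda>(i, j). A $$ (p i, p j))) =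
      det (mat n n (\<lambda>(i, j). transpose_mat B $$ (p i, j)))"
    using det_transpose[of "mat n n (\<lambda>(i, j). transpose_mat B $$ (p i, j))" n] by simp
  also have "\<dots> = signof p * (signof p * det A)"
    using det_permute_rows[of "transpose_mat B" n p] det_permute_rows[OF A p] det_transpose[OF B] B p
    by (simp add: B_def)
  also have "\<dots> = det A"
    using signof_pm_one[of p, where ?'a = 'a] by auto
  finally show ?thesis .
qed

section \<open>Block determinants over a commutative ring\<close>

text \<open>The library evaluates block triangular determinants only over integral domains.\<close>

lemma det_four_block_mat_one_lower_right:
  fixes A :: "'a::comm_ring_1 mat"
  assumes A: "A \<in> carrier_mat n n"
  shows "det (four_block_mat A (0\<^sub>m n k) (0\<^sub>m k n) (1\<^sub>m k)) = det A"
proof (induction k)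
  case 0
  have "four_block_mat A (0\<^sub>m n 0) (0\<^sub>m 0 n) (1\<^sub>m 0) = A"
    using A by (intro eq_matI) auto
  then show ?case by simp
next
  case (Suc k)
  let ?M = "four_block_mat A (0\<^sub>m n k) (0\<^sub>m k n) (1\<^sub>m k)"
  have "1\<^sub>m (Suc k) = four_block_mat (1\<^sub>m k) (0\<^sub>m k 1) (0\<^sub>m 1 k) (1\<^sub>m 1 :: 'a mat)"
    by (rule eq_matI) auto
  then have "four_block_mat A (0\<^sub>m n (Suc k)) (0\<^sub>m (Suc k) n) (1\<^sub>m (Suc k)) =
      four_block_mat ?M (0\<^sub>m (n + k) 1) (0\<^sub>m 1 (n + k)) (1\<^sub>m 1)"
    using A assoc_four_block_mat[of A "1\<^sub>m k" "1\<^sub>m 1"] by simp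
  also have "det \<dots> = det ?M * det (1\<^sub>m 1 :: 'a mat)"
    using A by (intro det_four_block_mat_upper_right_zero_col[of _ "n + k"]) auto
  finally show ?case by (simp add: Suc.IH)
qed

lemma det_four_block_mat_one_upper_left:
  fixes D :: "'a::comm_ring_1 mat"
  assumes "B \<in> carrier_mat n k" and D: "D \<in> carrier_mat k k"
  shows "det (four_block_mat (1\<^sub>m n) B (0\<^sub>m k n) D) = det D"
  using assms(1)
proof (induction n arbitrary: B)
  case 0
  then have "four_block_mat (1\<^sub>m 0) B (0\<^sub>m k 0) D = D"
    using D by (intro eq_matI) auto
  then show ?case by simp
next
  case (Suc n)
  \<comment> \<open>\<open>B'\<close> is \<open>B\<close> without its first row; that row, behind
    the zeros of the identity block, is \<open>b\<close>, so one leading 1 splits off.\<close>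
  define B' where "B' = mat n k (\<lambda>(i, j). B $$ (Suc i, j))"
  define b where "b = mat 1 (n + k) (\<lambda>(i, j). if j < n then 0 else B $$ (0, j - n))"
  let ?M = "four_block_mat (1\<^sub>m n) B' (0\<^sub>m k n) D"
  have B': "B' \<in> carrier_mat n k" by (simp add: B'_def)
  have "four_block_mat (1\<^sub>m (Suc n)) B (0\<^sub>m k (Suc n)) D =
      four_block_mat (1\<^sub>m 1) b (0\<^sub>m (n + k) 1) ?M"
  proof (rule eq_matI, goal_cases)
    case (1 i j)
    then show ?case
      using Suc.prems D by (cases i; cases j) (simp_all add: b_def B'_def)
  qed (use D B' in \<open>simp_all add: b_def\<close>)
  also have "det \<dots> = det (1\<^sub>m 1 :: 'a mat) * det ?M"
    using D B' by (intro det_four_block_mat_lower_left_zero_col[where n = "n + k"]) (auto simp: b_def)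
  finally show ?case by (simp add: Suc.IH[OF B'])
qed

text \<open>The factorization \<open>?L * ?R\<close> puts each diagonal block next to an identity
  block, where the two preceding lemmas apply.\<close>

lemma det_four_block_mat_lower_left_zero_comm_ring:
  fixes A :: "'a::comm_ring_1 mat"
  assumes A: "A \<in> carrier_mat n n" and B: "B \<in> carrier_mat n k" and D: "D \<in> carrier_mat k k"
  shows "det (four_block_mat A B (0\<^sub>m k n) D) = det A * det D"
proof -
  let ?L = "four_block_mat (1\<^sub>m n) B (0\<^sub>m k n) D"
  let ?R = "four_block_mat A (0\<^sub>m n k) (0\<^sub>m k n) (1\<^sub>m k)"
  have "?L * ?R = four_block_mat A B (0\<^sub>m k n) D"
    using A B D by (subst mult_four_block_mat[of _ n n _ k _ k]) auto
  moreover have "det (?L * ?R) = det ?L * det ?R"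
    using A B D by (intro det_mult[of _ "n + k"]) auto
  ultimately show ?thesis
    by (simp add: det_four_block_mat_one_lower_right[OF A]
        det_four_block_mat_one_upper_left[OF B D] mult.commute)
qed

text \<open>The lower left block is a multiple of \<open>D\<close>, so subtracting the last block
  column times \<open>E\<close> clears it without inverting \<open>D\<close>. The factor
  \<open>?U\<close> undoes this operation.\<close>

lemma det_four_block_mat_eliminate_lower_left:
  fixes A :: "'a::comm_ring_1 mat"
  assumes A: "A \<in> carrier_mat n n" and B: "B \<in> carrier_mat n k"
    and D: "D \<in> carrier_mat k k" and E: "E \<in> carrier_mat k n"
  shows "det (four_block_mat A B (D * E) D) = det (A - B * E) * det D"
proof -
  let ?U = "four_block_mat (1\<^sub>m n) (0\<^sub>m n k) E (1\<^sub>m k)"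
  let ?V = "four_block_mat (A - B * E) B (0\<^sub>m k n) D"
  have "A - B * E + B * E = A"
    using A B E by (intro eq_matI) auto
  then have "?V * ?U = four_block_mat A B (D * E) D"
    using A B D E
    by (subst mult_four_block_mat[OF minus_carrier_mat[OF mult_carrier_mat[OF B E]] B
          zero_carrier_mat D one_carrier_mat zero_carrier_mat E one_carrier_mat]) simp_all
  moreover have "det (?V * ?U) = det ?V * det ?U"
    using A B D E by (intro det_mult[of _ "n + k"]) auto
  moreover have "det ?V = det (A - B * E) * det D"
    using A B D E by (intro det_four_block_mat_lower_left_zero_comm_ring) auto
  moreover have "det ?U = 1"
  proof -
    have "det ?U = det (transpose_mat ?U)"
      using E det_transpose[of ?U "n + k"] by simp
    also have "transpose_mat ?U = four_block_mat (1\<^sub>m n) (transpose_mat E) (0\<^sub>m k n) (1\<^sub>m k)"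
      using E by (intro eq_matI) auto
    finally show ?thesis
      using E by (simp add: det_four_block_mat_one_upper_left)
  qed
  ultimately show ?thesis by simp
qed

section \<open>The matrix with blocks indexed by the maximum\<close>

lemma mat_eq_four_block_mat:
  "mat (n + k) (n + k) f = four_block_mat (mat n n f) (mat n k (\<lambda>(i, j). f (i, n + j)))
     (mat k n (\<lambda>(i, j). f (n + i, j))) (mat k k (\<lambda>(i, j). f (n + i, n + j)))"
  by (rule eq_matI) simp_all

text \<open>The quotient \<open>i div N\<close> is the position inside the blocks of G and
  \<open>i mod N\<close> is the block number, both from 0; for \<open>G_mat\<close> quotient and
  remainder have the opposite roles.\<close>

definition max_block_mat :: "nat \<Rightarrow> nat \<Rightarrow> (nat \<Rightarrow> nat \<Rightarrow> nat \<Rightarrow> 'a) \<Rightarrow> 'a mat" where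
  "max_block_mat N m y =
     mat (m * N) (m * N) (\<lambda>(i, j). y (max (i div N) (j div N)) (i mod N) (j mod N))"

lemma div_block_less:
  fixes i :: nat
  assumes "i < m * N"
  shows "i div N < m"
  using assms by (simp add: less_mult_imp_div_less)

lemma det_max_block_mat_Suc:
  fixes y :: "nat \<Rightarrow> nat \<Rightarrow> nat \<Rightarrow> 'a::comm_ring_1"
  assumes "N > 0"
  shows "det (max_block_mat N (Suc m) y) =
    det (max_block_mat N m (\<lambda>k r s. y k r s - y m r s)) * det (mat N N (\<lambda>(r, s). y m r s))"
proof -
  define A where "A = max_block_mat N m y"
  define B where "B = mat (m * N) N (\<lambda>(i, j). y m (i mod N) j)"
  define D where "D = mat N N (\<lambda>(r, s). y m r s)"
  \<comment> \<open>A row of \<open>m\<close> identity blocks: multiplying by \<open>E\<close> on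
    the right repeats the last block column \<open>m\<close> times.\<close>
  define E :: "'a mat" where "E = mat N (m * N) (\<lambda>(i, j). if i = j mod N then 1 else 0)"
  have carrier: "A \<in> carrier_mat (m * N) (m * N)" "B \<in> carrier_mat (m * N) N"
      "D \<in> carrier_mat N N" "E \<in> carrier_mat N (m * N)"
    by (simp_all add: A_def B_def D_def E_def max_block_mat_def)
  have mod_less: "j mod N < N" for j
    using assms by simp
  have DE: "D * E = mat N (m * N) (\<lambda>(i, j). y m i (j mod N))"
    by (rule eq_matI) (auto simp: D_def E_def scalar_prod_def if_distrib mod_less cong: if_cong)
  have BE: "B * E = mat (m * N) (m * N) (\<lambda>(i, j). y m (i mod N) (j mod N))"
    by (rule eq_matI) (auto simp: B_def E_def scalar_prod_def if_distrib mod_less cong: if_cong)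
  have "max_block_mat N (Suc m) y = mat (m * N + N) (m * N + N)
      (\<lambda>(i, j). y (max (i div N) (j div N)) (i mod N) (j mod N))"
    by (simp add: max_block_mat_def add.commute)
  \<comment> \<open>The last block index \<open>m\<close> exceeds all others, so \<open>max\<close>
    is \<open>m\<close> in every block outside the upper left part.\<close>
  also have "\<dots> = four_block_mat A B (D * E) D"
    unfolding DE mat_eq_four_block_mat[of "m * N" N]
    unfolding A_def B_def D_def max_block_mat_def
    by (intro cong[OF cong[OF cong[OF arg_cong[where f = four_block_mat]]]] cong_mat)
      (simp_all add: div_block_less[THEN less_imp_le] max.absorb1 max.absorb2)
  finally have "max_block_mat N (Suc m) y = four_block_mat A B (D * E) D" .
  moreover have "A - B * E = max_block_mat N m (\<lambda>k r s. y k r s - y m r s)"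
    unfolding BE by (rule eq_matI) (auto simp: A_def max_block_mat_def)
  ultimately show ?thesis
    using det_four_block_mat_eliminate_lower_left[OF carrier] by (simp add: D_def)
qed

text \<open>The zero matrix at index \<open>m\<close> lets the last factor be written as a
  difference too. The induction varies \<open>y\<close>, since subtracting \<open>y m\<close> gives
  a family that again vanishes at index \<open>m\<close>.\<close>

lemma det_max_block_mat:
  fixes y :: "nat \<Rightarrow> nat \<Rightarrow> nat \<Rightarrow> 'a::comm_ring_1"
  assumes "N > 0" and "\<And>r s. r < N \<Longrightarrow> s < N \<Longrightarrow> y m r s = 0"
  shows "det (max_block_mat N m y) =
    (\<Prod>k<m. det (mat N N (\<lambda>(r, s). y k r s - y (Suc k) r s)))"
  using assms(2)
proof (induction m arbitrary: y)
  case 0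
  then show ?case by (simp add: max_block_mat_def)
next
  case (Suc m)
  have last: "mat N N (\<lambda>(r, s). y m r s - y (Suc m) r s) = mat N N (\<lambda>(r, s). y m r s)"
    by (rule eq_matI) (auto simp: Suc.prems)
  show ?case
    using assms(1) by (simp add: det_max_block_mat_Suc Suc.IH last)
qed

section \<open>Regrouping the indices of G\<close>

text \<open>
  Position \<open>p\<close> in block row \<open>r\<close> of the block matrix of \<open>Y\<close>'s comes from position \<open>p\<close>, reversed for
  odd \<open>r\<close>, in block \<open>r\<close> of \<open>G\<close>; counting starts at \<open>0\<close>, so odd \<open>r\<close> means an even block of the paper.
\<close>

definition regroup :: "nat \<Rightarrow> nat \<Rightarrow> nat \<Rightarrow> nat" where
  "regroup N m i =
     (if i < N * m
      then i mod N * m + (if even (i mod N) then i div N else m - 1 - i div N) else i)"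

lemma regroup_coords:
  assumes "i < N * m"
  shows "regroup N m i div m = i mod N"
    and "regroup N m i mod m = (if even (i mod N) then i div N else m - 1 - i div N)"
proof -
  define t where "t = (if even (i mod N) then i div N else m - 1 - i div N)"
  have "i div N < m"
    using assms div_block_less[of i m N] by (simp add: mult.commute)
  then have "t < m" by (auto simp: t_def)
  moreover have "regroup N m i = i mod N * m + t"
    using assms by (simp add: regroup_def t_def)
  ultimately show "regroup N m i div m = i mod N"
    and "regroup N m i mod m = (if even (i mod N) then i div N else m - 1 - i div N)"
    by (simp_all add: t_def)
qed

lemma regroup_permutes: "regroup N m permutes {0..<N * m}"
proof (rule inj_imp_permutes)
  show "inj_on (regroup N m) {0..<N * m}"
  proof (rule inj_onI)
    fix i j
    assume "i \<in> {0..<N * m}" "j \<in> {0..<N * m}" and eq: "regroup N m i = regroup N m j"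
    then have i: "i < N * m" and j: "j < N * m" by simp_all
    have div: "i div N < m" "j div N < m"
      using i j by (simp_all add: div_block_less mult.commute)
    have mod_eq: "i mod N = j mod N"
      using regroup_coords(1)[OF i] regroup_coords(1)[OF j] eq by simp
    \<comment> \<open>Both indices lie in the same block, so either both positions are reversed or
      neither is.\<close>
    have "i div N = j div N"
      using regroup_coords(2)[OF i] regroup_coords(2)[OF j] eq mod_eq div
      by (cases "even (j mod N)") simp_all
    with mod_eq show "i = j" by (metis div_mult_mod_eq)
  qed
next
  fix i assume "i \<in> {0..<N * m}"
  then have i: "i < N * m" by simp
  then have "N > 0" "m > 0" by (auto intro: gr0I)
  then have "regroup N m i div m < N" by (simp add: regroup_coords(1)[OF i])
  with \<open>m > 0\<close> show "regroup N m i \<in> {0..<N * m}" by (simp add: div_less_iff_less_mult)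
qed (simp_all add: regroup_def)

text \<open>Counted from 1, reversal sends p to m + 1 - p. This cancels the reversed index in the C
  and D blocks and turns m + 1 - min into max in the A blocks.\<close>

lemma G_block_reverse_even:
  assumes "p < m" and "q < m"
  shows "G_block m x (Suc r) (Suc s) $$
      (if even r then p else m - 1 - p, if even s then q else m - 1 - q) =
    x (Suc r) (Suc s) (Suc (max p q))"
proof -
  have min_rev: "m - min (m - Suc p) (m - Suc q) = Suc (max p q)"
    using assms by linarith
  show ?thesis
    using assms
    by (cases "even r"; cases "even s")
      (simp_all add: G_block_def A_mat_def B_mat_def C_mat_def D_mat_def mat1_def min_rev)
qed

lemma G_mat_regroup:
  assumes i: "i < N * m" and j: "j < N * m"
  shows "G_mat N m x $$ (regroup N m i, regroup N m j) =
    x (Suc (i mod N)) (Suc (j mod N)) (Suc (max (i div N) (j div N)))"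
proof -
  have "regroup N m i < N * m" "regroup N m j < N * m"
    using permutes_in_image[OF regroup_permutes] i j by simp_all
  moreover have "i div N < m" "j div N < m"
    using i j by (simp_all add: div_block_less mult.commute)
  ultimately show ?thesis
    by (simp only: G_mat_def block_mat_def index_mat split regroup_coords[OF i]
        regroup_coords[OF j] Suc_eq_plus1[symmetric] G_block_reverse_even)
qed

theorem theorem4p1:
  fixes N m :: nat and x :: "nat \<Rightarrow> nat \<Rightarrow> nat \<Rightarrow> 'a::comm_ring_1"
  assumes "N \<ge> 2" and "m \<ge> 1"
    and "\<And>r s. r \<in> {1..N} \<Longrightarrow> s \<in> {1..N} \<Longrightarrow> x r s (m + 1) = 0"
  shows "det (G_mat N m x) = (\<Prod>i = 1..m. det (X_mat N x i))"
proof -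
  define y where "y k r s = x (Suc r) (Suc s) (Suc k)" for k r s
  have "G_mat N m x \<in> carrier_mat (N * m) (N * m)"
    by (simp add: G_mat_def block_mat_def)
  then have "det (G_mat N m x) =
      det (mat (N * m) (N * m) (\<lambda>(i, j). G_mat N m x $$ (regroup N m i, regroup N m j)))"
    using det_permute_rows_cols[OF _ regroup_permutes] by metis
  also have "mat (N * m) (N * m) (\<lambda>(i, j). G_mat N m x $$ (regroup N m i, regroup N m j)) =
      max_block_mat N m y"
    by (rule eq_matI) (auto simp: max_block_mat_def y_def G_mat_regroup mult.commute)
  also have "det \<dots> = (\<Prod>k<m. det (mat N N (\<lambda>(r, s). y k r s - y (Suc k) r s)))"
    using assms by (intro det_max_block_mat) (auto simp: y_def)
  also have "\<dots> = (\<Prod>k<m. det (X_mat N x (Suc k)))"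
    by (simp add: X_mat_def mat1_def y_def)
  also have "\<dots> = (\<Prod>i = 1..m. det (X_mat N x i))"
    by (rule prod.reindex_bij_witness[of _ "\<lambda>i. i - 1" Suc]) auto
  finally show ?thesis .
qed

end
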